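(* Let $A$ be a unital complex $C^*$-algebra and let $\lambda_1,\dots,\lambda_n\in\mathbb R$. Put $d=\min_{1\le\alpha,\beta\le n,\ \alpha\ne\beta}|\lambda_\alpha-\lambda_\beta|$. Then the distance of any two different connected components of $S_p(A)$ is at least $$d\cdot\min_{1\le i\le n}\ \frac{\displaystyle\prod_{\substack{1\le j\le n\\ j\ne i}}|\lambda_i-\lambda_j|}{\displaystyle\prod_{\substack{1\le j\le n\\ j\ne i}}\Bigl(\max_{k\ne j}|\lambda_k-\lambda_j|+d\Bigr)-\prod_{\substack{1\le j\le n\\ j\ne i}}\max_{k\ne j}|\lambda_k-\lambda_j|}.$$
   Context: Fix an integer $n\ge2$ and distinct $\lambda_1,\dots,\lambda_n$, and let $p(\lambda)=\prod_{i=1}^n(\lambda-\lambda_i)$. For a unital complex $C^*$-algebra $A$, $S_p(A)=\{a\in A\mid a=a^*,\ p(a)=0\}$, with the norm topology of $A$. The distance of two subsets $C,D$ of $A$ is $\inf\{\|a-b\|\mid a\in C,\ b\in D\}$. In the maxima, $k$ ranges over $\{1,\dots,n\}\setminus\{j\}$. *)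

theory Defs
  imports "HOL-Analysis.Analysis" "HOL-Computational_Algebra.Polynomial"
begin

text \<open>Built on \<open>real_normed_algebra\<close> and \<open>monoid_mult\<close> rather than on \<open>real_normed_algebra_1\<close>,
  which requires \<open>0 \<noteq> 1\<close> and would exclude the zero algebra. Submultiplicativity of the norm,
  completeness and the unit laws come from the parent classes.\<close>

class unital_cstar_algebra = real_normed_algebra + banach + monoid_mult +
  fixes scaleC :: "complex \<Rightarrow> 'a \<Rightarrow> 'a"  (infixr \<open>*\<^sub>C\<close> 75)
    and star :: "'a \<Rightarrow> 'a"
  assumes scaleR_eq_scaleC: "r *\<^sub>R x = complex_of_real r *\<^sub>C x"
    and scaleC_add_right: "c *\<^sub>C (x + y) = c *\<^sub>C x + c *\<^sub>C y"
    and scaleC_add_left: "(b + c) *\<^sub>C x = b *\<^sub>C x + c *\<^sub>C x"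
    and scaleC_scaleC: "b *\<^sub>C c *\<^sub>C x = (b * c) *\<^sub>C x"
    and mult_scaleC_left: "(c *\<^sub>C x) * y = c *\<^sub>C (x * y)"
    and mult_scaleC_right: "x * (c *\<^sub>C y) = c *\<^sub>C (x * y)"
    and norm_scaleC: "norm (c *\<^sub>C x) = cmod c * norm x"
    and star_star: "star (star x) = x"
    and star_add: "star (x + y) = star x + star y"
    and star_scaleC: "star (c *\<^sub>C x) = cnj c *\<^sub>C star x"
    and star_mult: "star (x * y) = star y * star x"
    and cstar_identity: "norm (star x * x) = (norm x)\<^sup>2"

definition poly_eval :: "real poly \<Rightarrow> 'a::unital_cstar_algebra \<Rightarrow> 'a" where
  "poly_eval p a = (\<Sum>k\<le>degree p. coeff p k *\<^sub>R a ^ k)"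

definition S_set :: "real poly \<Rightarrow> 'a::unital_cstar_algebra set" where
  "S_set p = {a. star a = a \<and> poly_eval p a = 0}"

definition root_poly :: "nat \<Rightarrow> (nat \<Rightarrow> real) \<Rightarrow> real poly" where
  "root_poly n l = (\<Prod>i\<in>{1..n}. [:- l i, 1:])"

definition min_gap :: "nat \<Rightarrow> (nat \<Rightarrow> real) \<Rightarrow> real" where
  "min_gap n l = Min {\<bar>l \<alpha> - l \<beta>\<bar> | \<alpha> \<beta>. \<alpha> \<in> {1..n} \<and> \<beta> \<in> {1..n} \<and> \<alpha> \<noteq> \<beta>}"

definition max_gap :: "nat \<Rightarrow> (nat \<Rightarrow> real) \<Rightarrow> nat \<Rightarrow> real" where
  "max_gap n l j = (MAX k\<in>{1..n} - {j}. \<bar>l k - l j\<bar>)"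

end

theory Submission
  imports Defs
begin

text \<open>
  Let \<open>d\<close> be the minimal gap of the \<open>\<lambda>\<^sub>i\<close>. Two points \<open>a\<close>, \<open>b\<close> of \<open>S\<^sub>p(A)\<close> with
  \<open>\<parallel>a - b\<parallel> < d\<close> always lie in the same component (\<open>close_points_in_connected_subset\<close>), so that
  different components have distance at least \<open>d\<close>. The bound of the theorem is at most \<open>d\<close>
  (\<open>bound_le_min_gap\<close>), because the fraction is at most \<open>1\<close> for an index \<open>i\<close> that takes part in
  the minimal gap.

  The idea behind the first fact: every point \<open>c\<^sub>t\<close> of the segment from \<open>a\<close> to \<open>b\<close> has distance
  less than \<open>d/2\<close> from \<open>a\<close> or from \<open>b\<close>. Since perturbation by a self-adjoint element moves the
  spectrum by at most its norm, the spectrum of \<open>c\<^sub>t\<close> avoids the midpoints between neighbouring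
  \<open>\<lambda>\<^sub>i\<close>, and rounding it to the nearest \<open>\<lambda>\<^sub>i\<close> is a continuous operation. The rounded segment is
  a path in \<open>S\<^sub>p(A)\<close> from \<open>a\<close> to \<open>b\<close>.

  This needs only a small part of the continuous functional calculus. The rounded element is
  \<open>\<Sum> \<lambda>\<^sub>i E\<^sub>i(t)\<close>, where \<open>E\<^sub>i(t) = (1 + sign y)/2\<close> with \<open>y = (d/2)\<^sup>2 - (c\<^sub>t - \<lambda>\<^sub>i)\<^sup>2\<close>, and the
  sign is \<open>y (y\<^sup>2)\<^sup>-\<^sup>1\<^sup>/\<^sup>2\<close>, given by a binomial series in \<open>y\<^sup>2/\<rho> - 1\<close>. There are three points
  to settle.

  \<^item> The series converges uniformly along the path if \<open>\<parallel>\<rho> - y\<^sup>2\<parallel>\<close> stays away from \<open>\<rho>\<close>. For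
    invertible self-adjoint \<open>y\<close> this follows from the \<open>C\<^sup>*\<close>-identity alone
    (\<open>norm_scalar_minus_square_invertible_le\<close>), by completing self-adjoint elements to
    unitaries with square roots from the same series.

  \<^item> The inverse of \<open>y\<close>, with a uniform bound, comes from the diagonal form
    \<open>a = \<Sum> \<lambda>\<^sub>i e\<^sub>i\<close> (\<open>S_set_diagonalisation\<close>) and a perturbation argument
    (\<open>window_right_inverse\<close>).

  \<^item> The \<open>E\<^sub>i(t)\<close> have to be orthogonal with sum \<open>1\<close>. They commute, so that
    \<open>E\<^sub>i(t) E\<^sub>j(t)\<close> is a projection, and by orthogonality so is \<open>1 - \<Sum> E\<^sub>i(t)\<close>. These
    projections vanish at \<open>t = 0\<close> and depend continuously on \<open>t\<close>, so they vanish for all \<open>t\<close>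
    (\<open>projection_path_zero\<close>). This avoids a comparison of the functions that define them.
\<close>

section \<open>Elementary rules for the involution\<close>

lemma star_scaleR: "star (r *\<^sub>R x) = r *\<^sub>R star (x :: 'a::unital_cstar_algebra)"
  by (simp add: scaleR_eq_scaleC star_scaleC)

lemma star_zero [simp]: "star (0 :: 'a::unital_cstar_algebra) = 0"
  using star_scaleR[of 0 "0::'a"] by simp

lemma star_one [simp]: "star (1 :: 'a::unital_cstar_algebra) = 1"
  using star_mult[of "star 1" "1::'a"] by (simp add: star_star)

lemma star_minus: "star (- x) = - star (x :: 'a::unital_cstar_algebra)"
  using star_scaleR[of "-1" x] by simp

lemma star_diff: "star (x - y) = star x - star (y :: 'a::unital_cstar_algebra)"
  using star_add[of x "- y"] by (simp add: star_minus)

lemma star_sum: "star (sum f I) = (\<Sum>i\<in>I. star (f i :: 'a::unital_cstar_algebra))"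
  by (induction I rule: infinite_finite_induct) (auto simp: star_add)

lemma star_power: "star (x ^ k) = star (x :: 'a::unital_cstar_algebra) ^ k"
  by (induction k) (auto simp: star_mult power_commutes)

lemma norm_star [simp]: "norm (star x) = norm (x :: 'a::unital_cstar_algebra)"
proof -
  have *: "norm y \<le> norm (star y)" for y :: 'a
  proof (cases "norm y = 0")
    case False
    have "norm y * norm y \<le> norm (star y) * norm y"
      using norm_mult_ineq[of "star y" y] by (simp add: cstar_identity power2_eq_square)
    then show ?thesis
      using False by (simp add: mult_le_cancel_right)
  qed simp
  show ?thesis
    using *[of x] *[of "star x"] by (simp add: star_star)
qed

lemma bounded_linear_star: "bounded_linear (star :: 'a::unital_cstar_algebra \<Rightarrow> 'a)"
  by (rule bounded_linear_intro[where K = 1]) (auto simp: star_add star_scaleR)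

lemma norm_square_selfadjoint:
  "star x = x \<Longrightarrow> norm (x * x) = (norm (x :: 'a::unital_cstar_algebra))\<^sup>2"
  using cstar_identity[of x] by simp

text \<open>The zero algebra is a unital $C^*$-algebra here, so that the norm of the unit is
  \<open>0\<close> or \<open>1\<close>.\<close>

lemma norm_one_le: "norm (1 :: 'a::unital_cstar_algebra) \<le> 1"
proof -
  have "norm (1::'a) = (norm (1::'a))\<^sup>2"
    using norm_square_selfadjoint[of "1::'a"] by simp
  then show ?thesis
    by (auto simp: power2_eq_square)
qed

lemma norm_power_le: "norm (x ^ k) \<le> norm (x :: 'a::unital_cstar_algebra) ^ k"
proof (induction k)
  case (Suc k)
  have "norm (x ^ Suc k) \<le> norm x * norm (x ^ k)"
    by (simp add: norm_mult_ineq)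
  also have "\<dots> \<le> norm x * norm x ^ k"
    using Suc by (simp add: mult_left_mono)
  finally show ?case by simp
qed (simp add: norm_one_le)

text \<open>If \<open>x\<close> and \<open>y\<close> commute, then \<open>u = x + iy\<close> satisfies \<open>u\<^sup>*u = M\<^sup>2\<close>, and \<open>x\<close> is the mean of
  \<open>u\<close> and \<open>u\<^sup>*\<close>. Norm bounds are obtained in this way below, without spectra.\<close>

lemma norm_le_of_sum_squares:
  fixes x y :: "'a::unital_cstar_algebra"
  assumes x: "star x = x" and y: "star y = y" and comm: "x * y = y * x"
    and sq: "x * x + y * y = (M\<^sup>2) *\<^sub>R 1" and M: "M \<ge> 0"
  shows "norm x \<le> M"
proof -
  define z where "z = \<i> *\<^sub>C y"
  have zz: "z * z = - (y * y)"
    using scaleR_eq_scaleC[of "-1" "y * y"]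
    by (simp add: z_def mult_scaleC_left mult_scaleC_right scaleC_scaleC)
  have sz: "star z = - z"
  proof -
    have "star z + z = (- \<i> + \<i>) *\<^sub>C y"
      unfolding z_def star_scaleC y scaleC_add_left by simp
    also have "\<dots> = 0"
      using scaleR_eq_scaleC[of 0 y] by simp
    finally show ?thesis by (simp add: eq_neg_iff_add_eq_0)
  qed
  have xz: "x * z = z * x"
    by (simp add: z_def mult_scaleC_left mult_scaleC_right comm)
  have "star (x + z) * (x + z) = (M\<^sup>2) *\<^sub>R 1"
    using sq by (simp add: star_add x sz algebra_simps zz xz)
  then have "(norm (x + z))\<^sup>2 = M\<^sup>2 * norm (1::'a)"
    using cstar_identity[of "x + z"] by simp
  also have "\<dots> \<le> M\<^sup>2"
    by (intro mult_left_le norm_one_le) simp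
  finally have u: "norm (x + z) \<le> M"
    using M by (rule power2_le_imp_le)
  have "2 *\<^sub>R x = (x + z) + star (x + z)"
    by (simp add: star_add x sz scaleR_2)
  then have "2 * norm x \<le> norm (x + z) + norm (star (x + z))"
    by (metis norm_triangle_ineq norm_scaleR abs_numeral)
  then show ?thesis
    using u by simp
qed

section \<open>Polynomials in an element and resolutions of the identity\<close>

lemma poly_eval_altdef:
  assumes "degree p \<le> N"
  shows "poly_eval p a = (\<Sum>k\<le>N. coeff p k *\<^sub>R a ^ k)"
  unfolding poly_eval_def
  by (rule sum.mono_neutral_left) (use assms in \<open>auto simp: coeff_eq_0\<close>)

lemma poly_eval_0 [simp]: "poly_eval 0 a = 0"
  by (simp add: poly_eval_def)

lemma poly_eval_1 [simp]: "poly_eval 1 a = 1"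
  by (simp add: poly_eval_def)

lemma poly_eval_add: "poly_eval (p + q) a = poly_eval p a + poly_eval q a"
proof -
  define N where "N = max (degree p) (degree q)"
  have "degree p \<le> N" "degree q \<le> N" "degree (p + q) \<le> N"
    by (auto simp: N_def degree_add_le_max)
  then show ?thesis
    by (simp add: poly_eval_altdef scaleR_add_left sum.distrib)
qed

lemma poly_eval_smult: "poly_eval (smult c p) a = c *\<^sub>R poly_eval p a"
  by (simp add: poly_eval_altdef[of _ "degree p"] degree_smult_le scaleR_sum_right)

lemma poly_eval_pCons: "poly_eval (pCons c p) a = c *\<^sub>R 1 + a * poly_eval p a"
  by (simp add: poly_eval_altdef[of _ "Suc (degree p)"] poly_eval_def degree_pCons_le
      sum.atMost_Suc_shift sum_distrib_left mult_scaleR_right del: sum.atMost_Suc)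

lemma poly_eval_mult: "poly_eval (p * q) a = poly_eval p a * poly_eval q a"
  by (induction p) (simp_all add: poly_eval_add poly_eval_smult poly_eval_pCons
      distrib_right mult.assoc mult_scaleR_left)

lemma poly_eval_sum: "poly_eval (sum f I) a = (\<Sum>i\<in>I. poly_eval (f i) a)"
  by (induction I rule: infinite_finite_induct) (simp_all add: poly_eval_add)

lemma poly_eval_eq_0_of_dvd: "p dvd q \<Longrightarrow> poly_eval p a = 0 \<Longrightarrow> poly_eval q a = 0"
  by (auto simp: dvd_def poly_eval_mult)

lemma star_poly_eval: "star a = a \<Longrightarrow> star (poly_eval p a) = poly_eval p a"
  by (simp add: poly_eval_def star_sum star_scaleR star_power)

definition resolution :: "'i set \<Rightarrow> ('i \<Rightarrow> 'a::unital_cstar_algebra) \<Rightarrow> bool" where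
  "resolution I e \<longleftrightarrow> finite I \<and> (\<forall>i\<in>I. star (e i) = e i) \<and>
     (\<forall>i\<in>I. \<forall>j\<in>I. e i * e j = (if i = j then e i else 0)) \<and> sum e I = 1"

definition diag :: "'i set \<Rightarrow> ('i \<Rightarrow> 'a::unital_cstar_algebra) \<Rightarrow> ('i \<Rightarrow> real) \<Rightarrow> 'a" where
  "diag I e \<mu> = (\<Sum>i\<in>I. \<mu> i *\<^sub>R e i)"

lemma diag_mult:
  assumes "resolution I e"
  shows "diag I e \<mu> * diag I e \<nu> = diag I e (\<lambda>i. \<mu> i * \<nu> i)"
proof -
  have "diag I e \<mu> * diag I e \<nu> = (\<Sum>i\<in>I. \<Sum>j\<in>I. (\<mu> i * \<nu> j) *\<^sub>R (e i * e j))"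
    by (simp add: diag_def sum_product mult_scaleR_left mult_scaleR_right mult.commute)
  also have "\<dots> = (\<Sum>i\<in>I. \<Sum>j\<in>I. if i = j then (\<mu> i * \<nu> i) *\<^sub>R e i else 0)"
    using assms by (intro sum.cong refl) (auto simp: resolution_def)
  also have "\<dots> = diag I e (\<lambda>i. \<mu> i * \<nu> i)"
    using assms by (simp add: resolution_def diag_def)
  finally show ?thesis .
qed

lemma diag_one: "resolution I e \<Longrightarrow> diag I e (\<lambda>i. 1) = 1"
  by (simp add: diag_def resolution_def)

lemma diag_const: "resolution I e \<Longrightarrow> diag I e (\<lambda>i. c) = c *\<^sub>R 1"
  by (simp add: diag_def resolution_def flip: scaleR_sum_right)

lemma diag_add: "diag I e \<mu> + diag I e \<nu> = diag I e (\<lambda>i. \<mu> i + \<nu> i)"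
  by (simp add: diag_def scaleR_add_left sum.distrib)

lemma diag_diff: "diag I e \<mu> - diag I e \<nu> = diag I e (\<lambda>i. \<mu> i - \<nu> i)"
  by (simp add: diag_def scaleR_diff_left sum_subtractf)

lemma diag_scaleR: "c *\<^sub>R diag I e \<mu> = diag I e (\<lambda>i. c * \<mu> i)"
  by (simp add: diag_def scaleR_sum_right)

lemma diag_power: "resolution I e \<Longrightarrow> diag I e \<mu> ^ k = diag I e (\<lambda>i. \<mu> i ^ k)"
  by (induction k) (simp_all add: diag_one diag_mult)

lemma star_diag: "resolution I e \<Longrightarrow> star (diag I e \<mu>) = diag I e \<mu>"
  by (simp add: diag_def star_sum star_scaleR resolution_def)

lemma diag_delta: "resolution I e \<Longrightarrow> i \<in> I \<Longrightarrow> diag I e (\<lambda>j. if j = i then 1 else 0) = e i"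
  by (simp add: diag_def resolution_def if_distribR if_distrib[of "\<lambda>c. c *\<^sub>R _"] cong: if_cong)

lemma poly_eval_diag:
  assumes "resolution I e"
  shows "poly_eval p (diag I e \<mu>) = diag I e (\<lambda>i. poly p (\<mu> i))"
proof -
  have "poly_eval p (diag I e \<mu>) = (\<Sum>k\<le>degree p. \<Sum>i\<in>I. (coeff p k * \<mu> i ^ k) *\<^sub>R e i)"
    by (simp add: poly_eval_def diag_power[OF assms] diag_scaleR) (simp add: diag_def)
  also have "\<dots> = (\<Sum>i\<in>I. \<Sum>k\<le>degree p. (coeff p k * \<mu> i ^ k) *\<^sub>R e i)"
    by (rule sum.swap)
  finally show ?thesis
    by (simp add: diag_def poly_altdef scaleR_sum_left)
qed

lemma norm_diag_le:
  assumes e: "resolution I e" and \<mu>: "\<And>i. i \<in> I \<Longrightarrow> \<bar>\<mu> i\<bar> \<le> M" and M: "M \<ge> 0"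
  shows "norm (diag I e \<mu>) \<le> M"
proof (rule norm_le_of_sum_squares[where y = "diag I e (\<lambda>i. sqrt (M\<^sup>2 - (\<mu> i)\<^sup>2))"])
  have "\<mu> i * \<mu> i + sqrt (M\<^sup>2 - (\<mu> i)\<^sup>2) * sqrt (M\<^sup>2 - (\<mu> i)\<^sup>2) = M\<^sup>2" if "i \<in> I" for i
  proof -
    have "(\<mu> i)\<^sup>2 \<le> M\<^sup>2"
      using \<mu>[OF that] by (simp add: abs_le_square_iff[symmetric] M)
    then show ?thesis by (simp add: power2_eq_square)
  qed
  then have "diag I e (\<lambda>i. \<mu> i * \<mu> i + sqrt (M\<^sup>2 - (\<mu> i)\<^sup>2) * sqrt (M\<^sup>2 - (\<mu> i)\<^sup>2)) = diag I e (\<lambda>i. M\<^sup>2)"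
    unfolding diag_def by (intro sum.cong) auto
  then show "diag I e \<mu> * diag I e \<mu> + diag I e (\<lambda>i. sqrt (M\<^sup>2 - (\<mu> i)\<^sup>2)) *
      diag I e (\<lambda>i. sqrt (M\<^sup>2 - (\<mu> i)\<^sup>2)) = M\<^sup>2 *\<^sub>R 1"
    by (simp add: diag_mult[OF e] diag_add diag_const[OF e])
qed (use M in \<open>simp_all add: star_diag[OF e] diag_mult[OF e] mult.commute\<close>)

lemma poly_root_poly: "poly (root_poly n l) x = (\<Prod>j\<in>{1..n}. x - l j)"
  by (simp add: root_poly_def poly_prod)

lemma diag_in_S_set:
  assumes "resolution {1..n} e"
  shows "diag {1..n} e l \<in> S_set (root_poly n l)"
proof -
  have "poly (root_poly n l) (l i) = 0" if "i \<in> {1..n}" for i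
    unfolding poly_root_poly by (rule prod_zero) (use that in auto)
  then show ?thesis
    using assms by (simp add: S_set_def star_diag poly_eval_diag) (simp add: diag_def)
qed

lemma prod_linear_dvd:
  fixes l :: "'i \<Rightarrow> 'b::idom"
  assumes "finite I" "inj_on l I" "\<And>i. i \<in> I \<Longrightarrow> poly q (l i) = 0"
  shows "(\<Prod>i\<in>I. [:- l i, 1:]) dvd q"
  using assms
proof (induction I rule: finite_induct)
  case (insert x F)
  then obtain k where k: "q = (\<Prod>i\<in>F. [:- l i, 1:]) * k"
    by (auto simp: dvd_def)
  have "poly q (l x) = 0"
    using insert.prems by simp
  moreover have "(\<Prod>i\<in>F. l x - l i) \<noteq> 0"
    using insert.hyps insert.prems(1) by (auto simp: inj_on_def)
  ultimately have "poly k (l x) = 0"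
    by (simp add: k poly_prod)
  then have "[:- l x, 1:] dvd k"
    by (simp add: poly_eq_0_iff_dvd)
  then have "[:- l x, 1:] * (\<Prod>i\<in>F. [:- l i, 1:]) dvd k * (\<Prod>i\<in>F. [:- l i, 1:])"
    by (rule mult_dvd_mono) simp
  then show ?case
    by (simp only: k prod.insert[OF insert.hyps] mult.commute[of k])
qed simp

text \<open>The projections are the Lagrange basis polynomials evaluated at the given element. A
  polynomial that vanishes at every \<open>l i\<close> is a multiple of \<open>root_poly n l\<close> and evaluates to \<open>0\<close>,
  so the identities between the projections hold because they hold at the points \<open>l i\<close>.\<close>

lemma S_set_diagonalisation:
  assumes a: "a \<in> S_set (root_poly n l)" and inj: "inj_on l {1..n}"
  obtains e where "resolution {1..n} e" "a = diag {1..n} e l"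
proof -
  define c where "c i = (\<Prod>j\<in>{1..n} - {i}. l i - l j)" for i
  define L where "L i = smult (inverse (c i)) (\<Prod>j\<in>{1..n} - {i}. [:- l j, 1:])" for i
  define e where "e i = poly_eval (L i) a" for i
  have vanish: "poly_eval p a = poly_eval q a"
    if "\<And>k. k \<in> {1..n} \<Longrightarrow> poly p (l k) = poly q (l k)" for p q
  proof -
    have "root_poly n l dvd p - q"
      unfolding root_poly_def by (rule prod_linear_dvd) (use that inj in auto)
    then have "poly_eval (p - q) a = 0"
      using a by (auto simp: S_set_def intro: poly_eval_eq_0_of_dvd)
    then show ?thesis
      using poly_eval_add[of "p - q" q a] by simp
  qed
  have L: "poly (L i) (l k) = (if i = k then 1 else 0)" if "i \<in> {1..n}" "k \<in> {1..n}" for i k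
  proof (cases "i = k")
    case True
    have "l i - l j \<noteq> 0" if "j \<in> {1..n} - {i}" for j
      using inj_onD[OF inj, of i j] that \<open>i \<in> {1..n}\<close> by auto
    then have "c i \<noteq> 0"
      unfolding c_def by (subst prod_zero_iff) auto
    moreover have "poly (\<Prod>j\<in>{1..n} - {i}. [:- l j, 1:]) (l i) = c i"
      unfolding poly_prod c_def by (rule prod.cong) simp_all
    ultimately show ?thesis
      using True by (simp add: L_def)
  next
    case False
    have "poly (\<Prod>j\<in>{1..n} - {i}. [:- l j, 1:]) (l k) = 0"
      unfolding poly_prod by (rule prod_zero) (use that False in auto)
    then show ?thesis
      using False by (simp only: L_def poly_smult mult_zero_right if_False)
  qed
  have mult: "e i * e j = (if i = j then e i else 0)" if ij: "i \<in> {1..n}" "j \<in> {1..n}" for i j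
  proof -
    have "e i * e j = poly_eval (L i * L j) a"
      by (simp add: e_def poly_eval_mult)
    also have "\<dots> = poly_eval (if i = j then L i else 0) a"
      by (rule vanish) (use ij in \<open>auto simp: L\<close>)
    finally show ?thesis
      by (auto simp: e_def)
  qed
  have "sum e {1..n} = poly_eval (\<Sum>i\<in>{1..n}. L i) a"
    by (simp add: e_def poly_eval_sum)
  also have "\<dots> = poly_eval 1 a"
    by (rule vanish) (simp add: poly_sum L)
  finally have one: "sum e {1..n} = 1"
    by simp
  have res: "resolution {1..n} e"
    using a mult one by (simp add: resolution_def S_set_def e_def star_poly_eval)
  have "a = poly_eval [:0, 1:] a"
    by (simp add: poly_eval_pCons)
  also have "\<dots> = poly_eval (\<Sum>i\<in>{1..n}. smult (l i) (L i)) a"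
    by (rule vanish) (simp add: poly_sum L if_distrib[of "(*) _"] cong: if_cong)
  also have "\<dots> = diag {1..n} e l"
    by (simp add: poly_eval_sum poly_eval_smult diag_def e_def)
  finally show ?thesis
    using that res by blast
qed

section \<open>The binomial series with exponent minus one half\<close>

abbreviation isqrt_coeff :: "nat \<Rightarrow> real" where
  "isqrt_coeff k \<equiv> (- 1 / 2) gchoose k"

lemma abs_isqrt_coeff_le: "\<bar>isqrt_coeff k\<bar> \<le> 1"
proof (induction k)
  case (Suc k)
  have "real (Suc k) * isqrt_coeff (Suc k) = (- 1 / 2 - real k) * isqrt_coeff k"
    using gbinomial_mult_1[of "- 1 / 2 :: real" k] by (simp add: algebra_simps)
  then have "\<bar>real (Suc k) * isqrt_coeff (Suc k)\<bar> = \<bar>(- 1 / 2 - real k) * isqrt_coeff k\<bar>"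
    by (rule arg_cong)
  moreover have "\<bar>- 1 / 2 - real k\<bar> = 1 / 2 + real k"
    by (simp add: abs_if)
  ultimately have "real (Suc k) * \<bar>isqrt_coeff (Suc k)\<bar> = (1 / 2 + real k) * \<bar>isqrt_coeff k\<bar>"
    by (simp only: abs_mult abs_of_nat)
  also have "\<dots> \<le> real (Suc k) * 1"
    using Suc by (intro mult_mono) auto
  finally show ?case
    by (simp del: of_nat_Suc)
qed simp

lemma gchoose_minus_one: "(- 1 :: real) gchoose k = (- 1) ^ k"
proof (induction k)
  case (Suc k)
  have "real (Suc k) * ((- 1) gchoose Suc k) = (- 1 - real k) * ((- 1) gchoose k)"
    using gbinomial_mult_1[of "- 1 :: real" k] by (simp add: algebra_simps)
  also have "\<dots> = real (Suc k) * (- 1) ^ Suc k"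
    by (simp add: Suc algebra_simps)
  finally have "real (Suc k) * ((- 1) gchoose Suc k) = real (Suc k) * (- 1) ^ Suc k" .
  then show ?case
    by (metis mult_left_cancel of_nat_neq_0)
qed simp

text \<open>The argument is the deviation from the unit: this is \<open>(1 + w)\<^sup>-\<^sup>1\<^sup>/\<^sup>2\<close>.\<close>

definition isqrt :: "'a::unital_cstar_algebra \<Rightarrow> 'a" where
  "isqrt w = (\<Sum>k. isqrt_coeff k *\<^sub>R w ^ k)"

lemma norm_isqrt_term_le:
  "norm (w :: 'a::unital_cstar_algebra) \<le> r \<Longrightarrow> norm (isqrt_coeff k *\<^sub>R w ^ k) \<le> r ^ k"
proof -
  assume "norm w \<le> r"
  then have "norm (w ^ k) \<le> r ^ k"
    by (meson norm_power_le norm_ge_zero order_trans power_mono)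
  moreover have "\<bar>isqrt_coeff k\<bar> * norm (w ^ k) \<le> 1 * norm (w ^ k)"
    by (intro mult_right_mono abs_isqrt_coeff_le) simp
  ultimately show ?thesis by simp
qed

lemma summable_norm_isqrt:
  assumes "norm (w :: 'a::unital_cstar_algebra) < 1"
  shows "summable (\<lambda>k. norm (isqrt_coeff k *\<^sub>R w ^ k))"
  by (rule summable_comparison_test'[where g = "\<lambda>k. norm w ^ k" and N = 0])
    (use assms norm_isqrt_term_le[of w "norm w"] in auto)

lemmas summable_isqrt = summable_norm_isqrt[THEN summable_norm_cancel]

lemma isqrt_commute:
  fixes w x :: "'a::unital_cstar_algebra"
  assumes w: "norm w < 1" and comm: "w * x = x * w"
  shows "isqrt w * x = x * isqrt w"
proof -
  have "isqrt w * x = (\<Sum>k. (isqrt_coeff k *\<^sub>R w ^ k) * x)"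
    unfolding isqrt_def by (rule suminf_mult2[OF summable_isqrt[OF w]])
  also have "\<dots> = (\<Sum>k. x * (isqrt_coeff k *\<^sub>R w ^ k))"
    by (simp add: mult_scaleR_left mult_scaleR_right power_commuting_commutes[OF comm])
  also have "\<dots> = x * isqrt w"
    unfolding isqrt_def by (rule suminf_mult[OF summable_isqrt[OF w]])
  finally show ?thesis .
qed

lemma star_isqrt:
  fixes w :: "'a::unital_cstar_algebra"
  assumes w: "norm w < 1" and "star w = w"
  shows "star (isqrt w) = isqrt w"
proof -
  have "star (isqrt w) = (\<Sum>k. star (isqrt_coeff k *\<^sub>R w ^ k))"
    unfolding isqrt_def
    by (rule bounded_linear.suminf[OF bounded_linear_star summable_isqrt[OF w]])
  then show ?thesis
    using assms(2) by (simp add: isqrt_def star_scaleR star_power)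
qed

text \<open>The Cauchy square of the series is the geometric series, by Vandermonde's identity for
  \<open>- 1/2 - 1/2 = - 1\<close>.\<close>

lemma isqrt_square:
  fixes w :: "'a::unital_cstar_algebra"
  assumes w: "norm w < 1"
  shows "(1 + w) * (isqrt w * isqrt w) = 1"
proof -
  define f where "f k = (- w) ^ k" for k
  have "(\<lambda>k. \<Sum>i\<le>k. (isqrt_coeff i *\<^sub>R w ^ i) * (isqrt_coeff (k - i) *\<^sub>R w ^ (k - i)))
      sums (isqrt w * isqrt w)"
    unfolding isqrt_def by (intro Cauchy_product_sums summable_norm_isqrt w)
  moreover have "(\<Sum>i\<le>k. (isqrt_coeff i *\<^sub>R w ^ i) * (isqrt_coeff (k - i) *\<^sub>R w ^ (k - i))) = f k"
    for k
  proof -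
    have "(\<Sum>i\<le>k. (isqrt_coeff i *\<^sub>R w ^ i) * (isqrt_coeff (k - i) *\<^sub>R w ^ (k - i))) =
        (\<Sum>i\<le>k. (isqrt_coeff i * isqrt_coeff (k - i)) *\<^sub>R w ^ k)"
      by (intro sum.cong refl)
        (simp add: mult_scaleR_left mult_scaleR_right mult.commute flip: power_add)
    also have "\<dots> = ((- 1 / 2 + - 1 / 2) gchoose k) *\<^sub>R w ^ k"
      unfolding scaleR_sum_left[symmetric] gbinomial_Vandermonde[symmetric] by (simp add: atLeast0AtMost)
    also have "\<dots> = f k"
      by (simp add: gchoose_minus_one f_def) (induction k; simp add: mult_scaleR_right[symmetric] del: mult_scaleR_right)
    finally show ?thesis .
  qed
  ultimately have f: "f sums (isqrt w * isqrt w)"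
    by simp
  have "(\<lambda>k. f (Suc k)) sums (- w * (isqrt w * isqrt w))"
    using sums_mult[OF f, of "- w"] by (simp add: f_def)
  then have "f sums (- w * (isqrt w * isqrt w) + 1)"
    by (subst (asm) sums_Suc_iff) (simp add: f_def)
  then have "isqrt w * isqrt w = - w * (isqrt w * isqrt w) + 1"
    using f sums_unique2 by blast
  from arg_cong[OF this, of "\<lambda>x. w * (isqrt w * isqrt w) + x"] show ?thesis
    by (simp only: distrib_right mult_minus_left add_minus_cancel mult_1_left add.commute[of "isqrt w * isqrt w"])
qed

lemma continuous_on_isqrt:
  assumes "r < 1"
  shows "continuous_on {w :: 'a::unital_cstar_algebra. norm w \<le> r} isqrt"
proof (rule uniform_limit_theorem)
  show "uniform_limit {w. norm w \<le> r} (\<lambda>n w. \<Sum>k<n. isqrt_coeff k *\<^sub>R w ^ k)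
      (isqrt :: 'a \<Rightarrow> 'a) sequentially"
    unfolding isqrt_def
  proof (cases "0 \<le> r")
    case True
    show "uniform_limit {w. norm w \<le> r} (\<lambda>n w. \<Sum>k<n. isqrt_coeff k *\<^sub>R w ^ k)
        (\<lambda>w :: 'a. \<Sum>k. isqrt_coeff k *\<^sub>R w ^ k) sequentially"
    proof (intro Weierstrass_m_test[where M = "\<lambda>k. r ^ k"])
      show "summable (\<lambda>k. r ^ k)"
        using True assms by (simp add: summable_geometric_iff)
    qed (rule norm_isqrt_term_le, simp)
  next
    case False
    then have empty: "{w :: 'a. norm w \<le> r} = {}"
      by (auto simp: not_le intro: less_le_trans)
    show "uniform_limit {w. norm w \<le> r} (\<lambda>n w. \<Sum>k<n. isqrt_coeff k *\<^sub>R w ^ k)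
        (\<lambda>w :: 'a. \<Sum>k. isqrt_coeff k *\<^sub>R w ^ k) sequentially"
      unfolding empty by (simp add: uniform_limit_iff)
  qed
qed (auto intro!: always_eventually continuous_intros)

lemma isqrt_diag:
  assumes e: "resolution I e" and r: "\<And>i. i \<in> I \<Longrightarrow> \<bar>\<mu> i\<bar> < 1"
  shows "isqrt (diag I e \<mu>) = diag I e (\<lambda>i. (1 + \<mu> i) powr (- 1 / 2))"
proof -
  have "(\<lambda>k. \<Sum>i\<in>I. (isqrt_coeff k * \<mu> i ^ k) *\<^sub>R e i) sums
      (\<Sum>i\<in>I. ((1 + \<mu> i) powr (- 1 / 2)) *\<^sub>R e i)"
    by (intro sums_sum sums_scaleR_left gen_binomial_real r)
  then show ?thesis
    using diag_power[OF e, of \<mu>] by (simp add: isqrt_def diag_scaleR) (simp add: diag_def sums_iff)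
qed

section \<open>Norm estimates that replace the order on self-adjoint elements\<close>

text \<open>In terms of the order, \<open>0 \<le> 1 - h\<^sup>2 \<le> 1\<close>. The square root \<open>g\<close> carries this information: it
  has norm at most \<open>1\<close> because \<open>g + ih\<close> is unitary.\<close>

lemma sqrt_one_minus_square:
  fixes h :: "'a::unital_cstar_algebra"
  assumes h: "star h = h" and less: "norm h < 1"
  obtains g where "star g = g" "g * g = 1 - h * h" "norm g \<le> 1"
    "\<And>x. x * h = h * x \<Longrightarrow> x * g = g * x"
proof -
  define w where "w = - (h * h)"
  define g where "g = (1 + w) * isqrt w"
  have sw: "star w = w"
    by (simp add: w_def star_minus star_mult h)
  have nw: "norm w < 1"
    using less by (simp add: w_def norm_square_selfadjoint h power_less_one_iff)
  have comm: "x * g = g * x" if "x * h = h * x" for x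
  proof -
    have w: "w * x = x * w"
      unfolding w_def by (metis that minus_mult_commute mult.assoc mult_minus_left)
    then have "isqrt w * x = x * isqrt w"
      by (rule isqrt_commute[OF nw])
    then show ?thesis
      unfolding g_def using w by (metis (no_types, lifting) distrib_left distrib_right mult.assoc mult_1_left mult_1_right)
  qed
  have wq: "isqrt w * w = w * isqrt w"
    by (rule isqrt_commute[OF nw]) simp
  have sg: "star g = g"
    by (simp add: g_def star_mult star_add sw star_isqrt[OF nw sw] distrib_left distrib_right wq)
  have "g * g = (1 + w) * ((1 + w) * (isqrt w * isqrt w))"
    unfolding g_def using wq by (metis (no_types, lifting) distrib_left distrib_right mult.assoc mult_1_left mult_1_right)
  then have gg: "g * g = 1 - h * h"
    by (simp add: isqrt_square[OF nw]) (simp add: w_def)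
  have "norm g \<le> 1"
    by (rule norm_le_of_sum_squares[OF sg h]) (simp_all add: comm gg)
  then show ?thesis
    using that sg gg comm by blast
qed

lemma norm_scalar_minus_square_le:
  fixes h :: "'a::unital_cstar_algebra"
  assumes h: "star h = h" and less: "(norm h)\<^sup>2 < \<rho>"
  shows "norm (\<rho> *\<^sub>R 1 - h * h) \<le> \<rho>"
proof -
  have \<rho>: "\<rho> > 0"
    using less by (meson le_less_trans zero_le_power2)
  define k where "k = (1 / sqrt \<rho>) *\<^sub>R h"
  have "norm k < 1"
    using less \<rho> by (simp add: k_def real_less_rsqrt)
  moreover have "star k = k"
    by (simp add: k_def star_scaleR h)
  ultimately obtain g where g: "star g = g" "g * g = 1 - k * k" "norm g \<le> 1"
    using sqrt_one_minus_square by blast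
  have "\<rho> *\<^sub>R 1 - h * h = \<rho> *\<^sub>R (g * g)"
    using \<rho> by (simp add: g k_def mult_scaleR_left mult_scaleR_right scaleR_diff_right)
  also have "norm \<dots> = \<rho> * (norm g)\<^sup>2"
    using \<rho> norm_square_selfadjoint[OF g(1)] by simp
  also have "\<dots> \<le> \<rho>"
    using \<rho> g(3) by (simp add: mult_left_le power_le_one)
  finally show ?thesis .
qed

text \<open>In terms of the order, \<open>h\<^sup>2 \<ge> \<epsilon>\<^sup>2\<close> because \<open>\<epsilon> \<parallel>j\<parallel> < 1\<close> for the inverse \<open>j\<close>. Indeed
  \<open>h\<^sup>2 - \<epsilon>\<^sup>2\<close> is the square of the self-adjoint element \<open>h g\<close>, where \<open>g\<^sup>2 = 1 - \<epsilon>\<^sup>2 j\<^sup>2\<close>, and the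
  preceding lemma applies to \<open>h g\<close>.\<close>

lemma norm_scalar_minus_square_invertible_le:
  fixes h j :: "'a::unital_cstar_algebra"
  assumes h: "star h = h" and inv: "h * j = 1" and \<epsilon>: "\<epsilon> > 0" "\<epsilon> * norm j < 1"
    and less: "(norm h)\<^sup>2 + \<epsilon>\<^sup>2 < \<rho>"
  shows "norm (\<rho> *\<^sub>R 1 - h * h) \<le> \<rho> - \<epsilon>\<^sup>2"
proof -
  have inv': "star j * h = 1"
    using arg_cong[OF inv, of star] by (simp add: star_mult h)
  have sj: "star j = j"
    by (metis inv inv' mult.assoc mult_1_left mult_1_right)
  define k where "k = \<epsilon> *\<^sub>R j"
  have "star k = k" "norm k < 1"
    using \<epsilon> by (simp_all add: k_def star_scaleR sj)
  then obtain g where g: "star g = g" "g * g = 1 - k * k" "norm g \<le> 1"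
    and comm: "\<And>x. x * k = k * x \<Longrightarrow> x * g = g * x"
    using sqrt_one_minus_square by metis
  have hg: "h * g = g * h"
    by (rule comm) (use inv inv' in \<open>simp add: k_def sj mult_scaleR_left mult_scaleR_right\<close>)
  have sm: "star (h * g) = h * g"
    by (simp add: star_mult h g hg)
  have "norm (h * g) \<le> norm h * norm g"
    by (rule norm_mult_ineq)
  also have "\<dots> \<le> norm h"
    using g(3) by (simp add: mult_left_le)
  finally have "(norm (h * g))\<^sup>2 \<le> (norm h)\<^sup>2"
    by (simp add: power_mono)
  then have "norm ((\<rho> - \<epsilon>\<^sup>2) *\<^sub>R 1 - (h * g) * (h * g)) \<le> \<rho> - \<epsilon>\<^sup>2"
    using less by (intro norm_scalar_minus_square_le sm) linarith
  moreover have "(h * g) * (h * g) = h * (h * (g * g))"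
    by (metis hg mult.assoc)
  moreover have "h * (h * (k * k)) = (\<epsilon>\<^sup>2) *\<^sub>R 1"
  proof -
    have "h * (h * (j * j)) = 1"
      by (metis inv mult.assoc mult_1_left)
    then show ?thesis
      by (simp add: k_def mult_scaleR_left mult_scaleR_right power2_eq_square)
  qed
  ultimately show ?thesis
    by (simp add: g right_diff_distrib scaleR_diff_left)
qed

text \<open>Since \<open>u + x = u (1 + j x)\<close>, it suffices to invert \<open>1 + w\<close> for \<open>w = j x\<close> of norm less than
  \<open>1\<close>, and \<open>isqrt w * isqrt w\<close> does this.\<close>

lemma perturbed_right_inverse:
  fixes u j x :: "'a::unital_cstar_algebra"
  assumes inv: "u * j = 1" "norm j \<le> \<beta>" and x: "norm x \<le> \<eta>" and less: "\<beta> * \<eta> < 1"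
  obtains k where "(u + x) * k = 1" "norm k \<le> \<beta> / (1 - \<beta> * \<eta>)"
proof -
  have \<beta>: "\<beta> \<ge> 0"
    using inv(2) norm_ge_zero order_trans by blast
  define w where "w = j * x"
  have "norm w \<le> norm j * norm x"
    unfolding w_def by (rule norm_mult_ineq)
  also have "\<dots> \<le> \<beta> * \<eta>"
    using inv x \<beta> by (intro mult_mono) auto
  finally have w: "norm w \<le> \<beta> * \<eta>" .
  define q where "q = isqrt w * isqrt w"
  have q: "(1 + w) * q = 1"
    unfolding q_def by (rule isqrt_square) (use w less in simp)
  have "q = 1 - w * q"
    using q by (simp add: distrib_right eq_diff_eq)
  then have "norm q \<le> norm (1::'a) + norm (w * q)"
    by (metis norm_triangle_ineq4)
  also have "\<dots> \<le> 1 + norm w * norm q"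
    by (intro add_mono norm_one_le norm_mult_ineq)
  also have "\<dots> \<le> 1 + \<beta> * \<eta> * norm q"
    using w by (simp add: mult_right_mono)
  finally have nq: "norm q \<le> 1 / (1 - \<beta> * \<eta>)"
    using less by (simp add: field_simps)
  have "u + x = u * (1 + w)"
    using inv(1) by (simp add: w_def distrib_left flip: mult.assoc)
  then have "(u + x) * (q * j) = u * (((1 + w) * q) * j)"
    by (simp only: mult.assoc)
  then have 1: "(u + x) * (q * j) = 1"
    by (simp add: q inv(1))
  have "norm (q * j) \<le> norm q * norm j"
    by (rule norm_mult_ineq)
  also have "\<dots> \<le> 1 / (1 - \<beta> * \<eta>) * \<beta>"
    using nq inv \<beta> less by (intro mult_mono) auto
  finally have "norm (q * j) \<le> \<beta> / (1 - \<beta> * \<eta>)"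
    by simp
  then show ?thesis
    using 1 that by blast
qed

section \<open>The sign of an invertible self-adjoint element\<close>

text \<open>For self-adjoint \<open>h\<close> this is \<open>h (h\<^sup>2)\<^sup>-\<^sup>1\<^sup>/\<^sup>2\<close>, whatever the value of \<open>\<rho>\<close>, as soon as the
  series converges.\<close>

definition sign_elt :: "real \<Rightarrow> 'a::unital_cstar_algebra \<Rightarrow> 'a" where
  "sign_elt \<rho> h = (1 / sqrt \<rho>) *\<^sub>R (h * isqrt ((1 / \<rho>) *\<^sub>R (h * h) - 1))"

lemma norm_sign_arg:
  fixes h :: "'a::unital_cstar_algebra"
  assumes "\<rho> > 0"
  shows "norm ((1 / \<rho>) *\<^sub>R (h * h) - 1) = norm (\<rho> *\<^sub>R 1 - h * h) / \<rho>"
proof -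
  have "(1 / \<rho>) *\<^sub>R (h * h) - 1 = - ((1 / \<rho>) *\<^sub>R (\<rho> *\<^sub>R 1 - h * h))"
    using assms by (simp add: scaleR_diff_right)
  then show ?thesis
    using assms by (simp only: norm_minus_cancel norm_scaleR) simp
qed

lemma
  fixes h :: "'a::unital_cstar_algebra"
  assumes h: "star h = h" and \<rho>: "\<rho> > 0" and less: "norm (\<rho> *\<^sub>R 1 - h * h) < \<rho>"
  shows star_sign_elt: "star (sign_elt \<rho> h) = sign_elt \<rho> h"
    and sign_elt_square: "sign_elt \<rho> h * sign_elt \<rho> h = 1"
    and sign_elt_commute: "x * h = h * x \<Longrightarrow> x * sign_elt \<rho> h = sign_elt \<rho> h * x"
proof -
  define w where "w = (1 / \<rho>) *\<^sub>R (h * h) - 1"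
  have s: "sign_elt \<rho> h = (1 / sqrt \<rho>) *\<^sub>R (h * isqrt w)"
    by (simp add: sign_elt_def w_def)
  have nw: "norm w < 1"
    using less \<rho> by (simp add: w_def norm_sign_arg)
  have sw: "star w = w"
    by (simp add: w_def star_diff star_scaleR star_mult h)
  have q: "isqrt w * x = x * isqrt w" if "x * h = h * x" for x
  proof (rule isqrt_commute[OF nw])
    have "h * h * x = x * (h * h)"
      by (metis that mult.assoc)
    then show "w * x = x * w"
      by (simp add: w_def left_diff_distrib right_diff_distrib mult_scaleR_left mult_scaleR_right)
  qed
  note qh = q[of h, simplified]
  show "star (sign_elt \<rho> h) = sign_elt \<rho> h"
    by (simp add: s star_scaleR star_mult h star_isqrt[OF nw sw] qh)
  have "(h * isqrt w) * (h * isqrt w) = h * h * (isqrt w * isqrt w)"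
    by (metis qh mult.assoc)
  also have "h * h = \<rho> *\<^sub>R (1 + w)"
    using \<rho> by (simp add: w_def)
  finally have "(h * isqrt w) * (h * isqrt w) = \<rho> *\<^sub>R 1"
    by (simp add: mult_scaleR_left isqrt_square[OF nw])
  then show "sign_elt \<rho> h * sign_elt \<rho> h = 1"
    using \<rho> by (simp add: s mult_scaleR_left mult_scaleR_right)
  show "x * sign_elt \<rho> h = sign_elt \<rho> h * x" if "x * h = h * x"
    using q[OF that] that
    by (simp add: s mult_scaleR_left mult_scaleR_right) (metis mult.assoc)
qed

lemma continuous_on_sign_elt:
  fixes f :: "'t::topological_space \<Rightarrow> 'a::unital_cstar_algebra"
  assumes f: "continuous_on T f" and \<rho>: "\<rho> > 0" and r: "r < \<rho>"
    and bound: "\<And>t. t \<in> T \<Longrightarrow> norm (\<rho> *\<^sub>R 1 - f t * f t) \<le> r"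
  shows "continuous_on T (\<lambda>t. sign_elt \<rho> (f t))"
proof -
  have "continuous_on T (\<lambda>t. isqrt ((1 / \<rho>) *\<^sub>R (f t * f t) - 1))"
  proof (rule continuous_on_compose2[OF continuous_on_isqrt[of "r / \<rho>"]])
    show "(\<lambda>t. (1 / \<rho>) *\<^sub>R (f t * f t) - 1) ` T \<subseteq> {w. norm w \<le> r / \<rho>}"
      using \<rho> bound by (auto simp: norm_sign_arg divide_right_mono)
  qed (use r \<rho> f in \<open>auto intro!: continuous_intros\<close>)
  then show ?thesis
    unfolding sign_elt_def using f by (auto intro!: continuous_intros)
qed

lemma sign_elt_diag:
  fixes e :: "'i \<Rightarrow> 'a::unital_cstar_algebra"
  assumes e: "resolution I e" and \<rho>: "\<rho> > 0"
    and \<mu>: "\<And>i. i \<in> I \<Longrightarrow> \<mu> i \<noteq> 0 \<and> (\<mu> i)\<^sup>2 < \<rho>"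
  shows "sign_elt \<rho> (diag I e \<mu>) = diag I e (\<lambda>i. sgn (\<mu> i))"
proof -
  have "(1 / \<rho>) *\<^sub>R (diag I e \<mu> * diag I e \<mu>) - 1 = diag I e (\<lambda>i. (\<mu> i)\<^sup>2 / \<rho> - 1)"
    unfolding diag_mult[OF e] diag_scaleR diag_one[OF e, symmetric] diag_diff
    by (simp add: power2_eq_square)
  also have "isqrt \<dots> = diag I e (\<lambda>i. (1 + ((\<mu> i)\<^sup>2 / \<rho> - 1)) powr (- 1 / 2))"
    using \<mu> \<rho> by (intro isqrt_diag[OF e]) (fastforce simp: abs_less_iff field_simps)
  finally have "sign_elt \<rho> (diag I e \<mu>) =
      diag I e (\<lambda>i. 1 / sqrt \<rho> * (\<mu> i * ((\<mu> i)\<^sup>2 / \<rho>) powr (- 1 / 2)))"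
    by (simp add: sign_elt_def diag_mult[OF e] diag_scaleR)
  also have "\<dots> = diag I e (\<lambda>i. sgn (\<mu> i))"
    unfolding diag_def
  proof (intro sum.cong refl arg_cong2[of _ _ _ _ scaleR])
    fix i assume "i \<in> I"
    then have "\<mu> i \<noteq> 0" using \<mu> by blast
    then show "1 / sqrt \<rho> * (\<mu> i * ((\<mu> i)\<^sup>2 / \<rho>) powr (- 1 / 2)) = sgn (\<mu> i)"
      using \<rho> by (simp add: powr_minus powr_half_sqrt real_sqrt_divide sgn_real_def field_simps abs_if)
  qed
  finally show ?thesis .
qed

section \<open>The path of spectral projections\<close>

text \<open>A continuous path of projections that starts at \<open>0\<close> stays at \<open>0\<close>, because the norm of a
  projection is \<open>0\<close> or \<open>1\<close>.\<close>

lemma projection_path_zero: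
  fixes N :: "real \<Rightarrow> 'a::unital_cstar_algebra"
  assumes cont: "continuous_on {0..1} N" and start: "N 0 = 0"
    and proj: "\<And>t. t \<in> {0..1} \<Longrightarrow> star (N t) = N t \<and> N t * N t = N t"
    and t: "t \<in> {0..1}"
  shows "N t = 0"
proof (rule ccontr)
  assume "N t \<noteq> 0"
  have norm: "norm (N s) = 0 \<or> norm (N s) = 1" if "s \<in> {0..1}" for s
  proof -
    have "norm (N s) = (norm (N s))\<^sup>2"
      using norm_square_selfadjoint[of "N s"] proj[OF that] by simp
    then show ?thesis by (simp add: power2_eq_square)
  qed
  have "norm (N t) = 1"
    using norm[OF t] \<open>N t \<noteq> 0\<close> by simp
  moreover have "continuous_on {0..t} (\<lambda>s. norm (N s))"
    using cont t by (intro continuous_on_norm continuous_on_subset[OF cont]) auto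
  ultimately obtain s where "0 \<le> s" "s \<le> t" "norm (N s) = 1 / 2"
    using IVT'[of "\<lambda>s. norm (N s)" 0 "1 / 2" t] t start by auto
  then show False
    using norm[of s] t by auto
qed

definition window :: "real \<Rightarrow> real \<Rightarrow> 'a::unital_cstar_algebra \<Rightarrow> 'a" where
  "window d m c = ((d / 2)\<^sup>2) *\<^sub>R 1 - (c - m *\<^sub>R 1) * (c - m *\<^sub>R 1)"

text \<open>The spectral projection of \<open>c\<close> for the open interval of length \<open>d\<close> centred at \<open>m\<close>.\<close>

definition window_proj :: "real \<Rightarrow> real \<Rightarrow> real \<Rightarrow> 'a::unital_cstar_algebra \<Rightarrow> 'a" where
  "window_proj \<rho> d m c = (1 / 2) *\<^sub>R (1 + sign_elt \<rho> (window d m c))"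

lemma star_window: "star c = c \<Longrightarrow> star (window d m c) = window d m c"
  by (simp add: window_def star_diff star_scaleR star_mult)

lemma window_commute: "window d m c * window d' m' c = window d' m' c * window d m c"
proof -
  define x where "x = c - m *\<^sub>R 1"
  define y where "y = c - m' *\<^sub>R 1"
  have "x * y = y * x"
    by (simp add: x_def y_def left_diff_distrib right_diff_distrib mult_scaleR_left
        mult_scaleR_right scaleR_diff_right mult.commute)
  then have "(x * x) * (y * y) = (y * y) * (x * x)"
    by (metis mult.assoc)
  then show ?thesis
    unfolding window_def x_def[symmetric] y_def[symmetric]
    by (simp add: left_diff_distrib right_diff_distrib mult_scaleR_left mult_scaleR_right
        scaleR_diff_right mult.commute)
qed

lemma window_diag:
  assumes e: "resolution I e"
  shows "window d m (diag I e l) = diag I e (\<lambda>k. (d / 2)\<^sup>2 - (l k - m)\<^sup>2)"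
  by (simp add: window_def diag_const[OF e, symmetric] diag_diff diag_mult[OF e] power2_eq_square)

lemma window_proj_diag:
  assumes e: "resolution I e" and i: "i \<in> I" and d: "d > 0" and \<rho>: "\<rho> > 0"
    and gap: "\<And>k. k \<in> I \<Longrightarrow> k \<noteq> i \<Longrightarrow> d \<le> \<bar>l k - l i\<bar>"
    and large: "\<And>k. k \<in> I \<Longrightarrow> ((d / 2)\<^sup>2 - (l k - l i)\<^sup>2)\<^sup>2 < \<rho>"
  shows "window_proj \<rho> d (l i) (diag I e l) = e i"
proof -
  have sgn: "sgn ((d / 2)\<^sup>2 - (l k - l i)\<^sup>2) = (if k = i then 1 else - 1)" if "k \<in> I" for k
  proof (cases "k = i")
    case False
    have "(d / 2)\<^sup>2 < d\<^sup>2"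
      using d by (simp add: power2_eq_square)
    also have "d\<^sup>2 \<le> (l k - l i)\<^sup>2"
      using gap[OF that False] d by (simp add: abs_le_square_iff[symmetric])
    finally show ?thesis
      using False by simp
  qed (use d in simp)
  have "sign_elt \<rho> (window d (l i) (diag I e l)) =
      diag I e (\<lambda>k. sgn ((d / 2)\<^sup>2 - (l k - l i)\<^sup>2))"
    unfolding window_diag[OF e]
  proof (rule sign_elt_diag[OF e \<rho>], intro conjI large)
    show "(d / 2)\<^sup>2 - (l k - l i)\<^sup>2 \<noteq> 0" if "k \<in> I" for k
      using sgn[OF that] by (auto split: if_splits)
  qed
  then have "window_proj \<rho> d (l i) (diag I e l) =
      diag I e (\<lambda>k. 1 / 2 * (1 + sgn ((d / 2)\<^sup>2 - (l k - l i)\<^sup>2)))"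
    by (simp only: window_proj_def diag_one[OF e, symmetric] diag_add diag_scaleR)
  also have "\<dots> = diag I e (\<lambda>k. if k = i then 1 else 0)"
    unfolding diag_def by (intro sum.cong refl) (simp add: sgn)
  finally show ?thesis
    by (simp add: diag_delta[OF e i])
qed

lemma diag_perturbation_right_inverse:
  fixes x :: "'a::unital_cstar_algebra"
  assumes e: "resolution I e" and \<mu>: "\<And>i. i \<in> I \<Longrightarrow> r \<le> \<bar>\<mu> i\<bar>"
    and x: "norm x \<le> \<eta>" and less: "\<eta> < r"
  obtains k where "(diag I e \<mu> + x) * k = 1" "norm k \<le> 1 / (r - \<eta>)"
proof -
  have r: "r > 0"
    using x less norm_ge_zero[of x] by linarith
  have "diag I e (\<lambda>i. \<mu> i * (1 / \<mu> i)) = diag I e (\<lambda>i. 1)"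
    unfolding diag_def using \<mu> r by (intro sum.cong refl) fastforce
  then have inv: "diag I e \<mu> * diag I e (\<lambda>i. 1 / \<mu> i) = 1"
    by (simp only: diag_mult[OF e] diag_one[OF e])
  have "\<bar>1 / \<mu> i\<bar> \<le> 1 / r" if "i \<in> I" for i
    using frac_le[of 1 1 r "\<bar>\<mu> i\<bar>"] \<mu>[OF that] r by simp
  then have "norm (diag I e (\<lambda>i. 1 / \<mu> i)) \<le> 1 / r"
    using r by (intro norm_diag_le[OF e]) simp_all
  moreover have "1 / r * \<eta> < 1"
    using r less by simp
  moreover have "1 / r / (1 - 1 / r * \<eta>) = 1 / (r - \<eta>)"
    using r less by (simp add: field_simps)
  ultimately show ?thesis
    using perturbed_right_inverse[OF inv _ x, of "1 / r"] that by metis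
qed

text \<open>Both ends \<open>l i \<plusminus> d/2\<close> of the window lie at distance at least \<open>d/2\<close> from all the
  \<open>l k\<close>, so that a perturbation of norm less than \<open>d/2\<close> keeps \<open>c\<close> minus either end invertible.
  The window element is minus the product of these two differences.\<close>

lemma window_right_inverse:
  fixes x :: "'a::unital_cstar_algebra"
  assumes e: "resolution I e" and c: "c = diag I e l + x" and x: "norm x \<le> \<eta>" and less: "\<eta> < d / 2"
    and gap: "\<And>k. k \<in> I \<Longrightarrow> k \<noteq> i \<Longrightarrow> d \<le> \<bar>l k - l i\<bar>"
  shows "\<exists>j. window d (l i) c * j = 1 \<and> norm j \<le> (1 / (d / 2 - \<eta>))\<^sup>2"
proof -
  have d: "d > 0"
    using x less norm_ge_zero[of x] by linarith
  have shift: "c - m *\<^sub>R 1 = diag I e (\<lambda>k. l k - m) + x" for m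
    by (simp add: c diag_const[OF e, symmetric] diag_diff[symmetric])
  have far: "d / 2 \<le> \<bar>l k - (l i + d / 2)\<bar>" "d / 2 \<le> \<bar>l k - (l i - d / 2)\<bar>" if "k \<in> I" for k
    using gap[OF that] d by (cases "k = i"; simp add: abs_if split: if_splits)+
  have inv: "\<exists>k. (c - m *\<^sub>R 1) * k = 1 \<and> norm k \<le> 1 / (d / 2 - \<eta>)"
    if m: "\<And>k. k \<in> I \<Longrightarrow> d / 2 \<le> \<bar>l k - m\<bar>" for m
    unfolding shift by (rule diag_perturbation_right_inverse[OF e m x less]) blast+
  obtain A where A: "(c - (l i + d / 2) *\<^sub>R 1) * A = 1" "norm A \<le> 1 / (d / 2 - \<eta>)"
    using inv[OF far(1)] by blast
  obtain B where B: "(c - (l i - d / 2) *\<^sub>R 1) * B = 1" "norm B \<le> 1 / (d / 2 - \<eta>)"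
    using inv[OF far(2)] by blast
  have "window d (l i) c = - ((c - (l i + d / 2) *\<^sub>R 1) * (c - (l i - d / 2) *\<^sub>R 1))"
    by (simp add: window_def left_diff_distrib right_diff_distrib mult_scaleR_left
        mult_scaleR_right scaleR_add_left scaleR_diff_left algebra_simps power2_eq_square)
  then have "window d (l i) c * (- (B * A)) =
      (c - (l i + d / 2) *\<^sub>R 1) * (((c - (l i - d / 2) *\<^sub>R 1) * B) * A)"
    by (simp only: mult_minus_left mult_minus_right minus_minus mult.assoc)
  then have "window d (l i) c * (- (B * A)) = 1"
    by (simp only: A B mult_1_left)
  moreover have "norm (- (B * A)) \<le> (1 / (d / 2 - \<eta>))\<^sup>2"
  proof -
    have "norm (- (B * A)) \<le> norm B * norm A"
      by (simp add: norm_mult_ineq)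
    also have "\<dots> \<le> 1 / (d / 2 - \<eta>) * (1 / (d / 2 - \<eta>))"
      using A(2) B(2) less by (intro mult_mono) auto
    finally show ?thesis
      by (simp add: power2_eq_square)
  qed
  ultimately show ?thesis
    by blast
qed

lemma close_points_in_connected_subset:
  fixes a b :: "'a::unital_cstar_algebra"
  assumes a: "a \<in> S_set (root_poly n l)" and b: "b \<in> S_set (root_poly n l)"
    and inj: "inj_on l {1..n}"
    and gap: "\<And>i k. i \<in> {1..n} \<Longrightarrow> k \<in> {1..n} \<Longrightarrow> k \<noteq> i \<Longrightarrow> d \<le> \<bar>l k - l i\<bar>"
    and close: "norm (a - b) < d"
  obtains T where "connected T" "T \<subseteq> S_set (root_poly n l)" "a \<in> T" "b \<in> T"
proof -
  define I where "I = {1..n}"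
  have fin: "finite I"
    by (simp add: I_def)
  obtain e where e: "resolution I e" and ae: "a = diag I e l"
    using S_set_diagonalisation[OF a inj] unfolding I_def by metis
  obtain f where f: "resolution I f" and bf: "b = diag I f l"
    using S_set_diagonalisation[OF b inj] unfolding I_def by metis
  have d: "d > 0"
    using close norm_ge_zero[of "a - b"] by linarith
  define \<delta> where "\<delta> = norm (a - b)"
  define c where "c t = a + t *\<^sub>R (b - a)" for t :: real
  have c0: "c 0 = a" and c1: "c 1 = b"
    by (simp_all add: c_def)
  have sc: "star (c t) = c t" for t
    using a b by (simp add: c_def star_add star_scaleR star_diff S_set_def)
  define y where "y i t = window d (l i) (c t)" for i t
  have cont_y: "continuous_on {0..1} (y i)" for i
    unfolding y_def window_def c_def by (intro continuous_intros)
  define \<beta> where "\<beta> = (1 / (d / 2 - \<delta> / 2))\<^sup>2"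
  have \<beta>: "\<beta> > 0"
    using close by (simp add: \<beta>_def \<delta>_def)
  \<comment> \<open>Every point of the segment is within half its length of one of its ends.\<close>
  have inv: "\<exists>j. y i t * j = 1 \<and> norm j \<le> \<beta>" if i: "i \<in> I" and t: "t \<in> {0..1}" for i t
  proof (cases "t \<le> 1 / 2")
    case True
    have "norm (t *\<^sub>R (b - a)) = t * \<delta>"
      using t by (simp add: \<delta>_def norm_minus_commute)
    also have "\<dots> \<le> 1 / 2 * \<delta>"
      using True by (intro mult_right_mono) (auto simp: \<delta>_def)
    finally have x: "norm (t *\<^sub>R (b - a)) \<le> \<delta> / 2"
      by simp
    have "c t = diag I e l + t *\<^sub>R (b - a)"
      by (simp add: c_def ae)
    then show ?thesis
      unfolding y_def \<beta>_def
      by (rule window_right_inverse[OF e _ x]) (use gap i close in \<open>auto simp: I_def \<delta>_def\<close>)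
  next
    case False
    have "norm ((1 - t) *\<^sub>R (a - b)) = (1 - t) * \<delta>"
      using t by (simp add: \<delta>_def)
    also have "\<dots> \<le> 1 / 2 * \<delta>"
      using False by (intro mult_right_mono) (auto simp: \<delta>_def)
    finally have x: "norm ((1 - t) *\<^sub>R (a - b)) \<le> \<delta> / 2"
      by simp
    have "c t = diag I f l + (1 - t) *\<^sub>R (a - b)"
      by (simp add: c_def bf[symmetric] algebra_simps)
    then show ?thesis
      unfolding y_def \<beta>_def
      by (rule window_right_inverse[OF f _ x]) (use gap i close in \<open>auto simp: I_def \<delta>_def\<close>)
  qed
  define \<epsilon> where "\<epsilon> = 1 / (2 * \<beta>)"
  have \<epsilon>: "\<epsilon> > 0"
    using \<beta> by (simp add: \<epsilon>_def)
  have "bounded (\<Union>i\<in>I. y i ` {0..1})"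
    by (intro bounded_UN fin ballI compact_imp_bounded compact_continuous_image cont_y) simp
  then obtain Y where Y: "\<And>i t. i \<in> I \<Longrightarrow> t \<in> {0..1} \<Longrightarrow> norm (y i t) \<le> Y"
    unfolding bounded_iff by blast
  have "bounded ((\<lambda>(i, k). (d / 2)\<^sup>2 - (l k - l i)\<^sup>2) ` (I \<times> I))"
    using fin by (intro finite_imp_bounded finite_imageI finite_cartesian_product)
  then obtain Z where Z: "\<And>i k. i \<in> I \<Longrightarrow> k \<in> I \<Longrightarrow> \<bar>(d / 2)\<^sup>2 - (l k - l i)\<^sup>2\<bar> \<le> Z"
    unfolding bounded_iff by fastforce
  \<comment> \<open>Beyond the norms of the \<open>y i t\<close>, the constant has to dominate the eigenvalues at both ends:
    an eigenvalue whose projection is \<open>0\<close> does not contribute to the norm.\<close>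
  define \<rho> where "\<rho> = Y\<^sup>2 + Z\<^sup>2 + \<epsilon>\<^sup>2 + 1"
  have \<rho>: "\<rho> > 0"
    by (simp add: \<rho>_def add_nonneg_pos)
  have large: "((d / 2)\<^sup>2 - (l k - l i)\<^sup>2)\<^sup>2 < \<rho>" if "i \<in> I" "k \<in> I" for i k
  proof -
    have "((d / 2)\<^sup>2 - (l k - l i)\<^sup>2)\<^sup>2 \<le> Z\<^sup>2"
      using Z[OF that] by (metis abs_ge_zero power2_abs power_mono)
    moreover have "0 \<le> Y\<^sup>2" "0 \<le> \<epsilon>\<^sup>2"
      by simp_all
    ultimately show ?thesis
      unfolding \<rho>_def by linarith
  qed
  have sy: "star (y i t) = y i t" for i t
    by (simp add: y_def star_window sc)
  have bound: "norm (\<rho> *\<^sub>R 1 - y i t * y i t) \<le> \<rho> - \<epsilon>\<^sup>2" if it: "i \<in> I" "t \<in> {0..1}" for i t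
  proof -
    obtain j where j: "y i t * j = 1" "norm j \<le> \<beta>"
      using inv[OF it] by blast
    have "\<epsilon> * norm j \<le> \<epsilon> * \<beta>"
      using j \<epsilon> by (simp add: mult_left_mono)
    also have "\<dots> < 1"
      using \<beta> by (simp add: \<epsilon>_def)
    finally have small: "\<epsilon> * norm j < 1" .
    have "(norm (y i t))\<^sup>2 \<le> Y\<^sup>2"
      using Y[OF it] by (simp add: power_mono)
    then have "(norm (y i t))\<^sup>2 + \<epsilon>\<^sup>2 < \<rho>"
      unfolding \<rho>_def using zero_le_power2[of Z] by linarith
    then show ?thesis
      by (rule norm_scalar_minus_square_invertible_le[OF sy j(1) \<epsilon> small])
  qed
  have strict: "norm (\<rho> *\<^sub>R 1 - y i t * y i t) < \<rho>" if "i \<in> I" "t \<in> {0..1}" for i t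
    using bound[OF that] \<epsilon> by (smt (verit) zero_less_power2)
  define E where "E i t = window_proj \<rho> d (l i) (c t)" for i t
  have E_def': "E i t = (1 / 2) *\<^sub>R (1 + sign_elt \<rho> (y i t))" for i t
    by (simp add: E_def window_proj_def y_def)
  have cont_E: "continuous_on {0..1} (E i)" if i: "i \<in> I" for i
  proof -
    have "continuous_on {0..1} (\<lambda>t. sign_elt \<rho> (y i t))"
      by (rule continuous_on_sign_elt[OF cont_y \<rho> _ bound[OF i]]) (use \<epsilon> in simp_all)
    then show ?thesis
      unfolding E_def' by (intro continuous_intros)
  qed
  have sE: "star (E i t) = E i t" if "i \<in> I" "t \<in> {0..1}" for i t
    by (simp add: E_def' star_scaleR star_add star_sign_elt[OF sy \<rho> strict[OF that]])
  have EE: "E i t * E i t = E i t" if "i \<in> I" "t \<in> {0..1}" for i t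
  proof -
    define s where "s = sign_elt \<rho> (y i t)"
    have "s * s = 1"
      unfolding s_def by (rule sign_elt_square[OF sy \<rho> strict[OF that]])
    then have "(1 + s) * (1 + s) = 2 *\<^sub>R (1 + s)"
      by (simp add: distrib_left distrib_right scaleR_2 algebra_simps)
    then show ?thesis
      by (simp add: E_def' s_def[symmetric] mult_scaleR_left mult_scaleR_right)
  qed
  have comm: "E i t * E k t = E k t * E i t" if "i \<in> I" "k \<in> I" "t \<in> {0..1}" for i k t
  proof -
    have "y i t * y k t = y k t * y i t"
      by (simp add: y_def window_commute)
    then have "y i t * sign_elt \<rho> (y k t) = sign_elt \<rho> (y k t) * y i t"
      by (rule sign_elt_commute[OF sy \<rho> strict[OF that(2,3)]])
    then have "sign_elt \<rho> (y k t) * sign_elt \<rho> (y i t) = sign_elt \<rho> (y i t) * sign_elt \<rho> (y k t)"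
      by (intro sign_elt_commute[OF sy \<rho> strict[OF that(1,3)]]) simp
    then show ?thesis
      by (simp add: E_def' mult_scaleR_left mult_scaleR_right distrib_left distrib_right
          scaleR_add_right add_ac)
  qed
  have proj_diag: "window_proj \<rho> d (l i) (diag I g l) = g i"
    if g: "resolution I g" and i: "i \<in> I" for g :: "nat \<Rightarrow> 'a" and i
    by (rule window_proj_diag[OF g i d \<rho>]) (use gap large i in \<open>auto simp: I_def\<close>)
  have E0: "E i 0 = e i" and E1: "E i 1 = f i" if i: "i \<in> I" for i
    by (simp_all only: E_def c0 c1 ae bf proj_diag[OF e i] proj_diag[OF f i])
  have orth: "E i t * E k t = 0" if ik: "i \<in> I" "k \<in> I" "i \<noteq> k" and t: "t \<in> {0..1}" for i k t
  proof (rule projection_path_zero[of "\<lambda>t. E i t * E k t", OF _ _ _ t])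
    show "continuous_on {0..1} (\<lambda>t. E i t * E k t)"
      by (intro continuous_on_mult cont_E ik)
    show "E i 0 * E k 0 = 0"
      using e ik by (simp add: E0 resolution_def)
    fix s :: real assume s: "s \<in> {0..1}"
    have "star (E i s * E k s) = E i s * E k s"
      by (simp only: star_mult sE[OF ik(1) s] sE[OF ik(2) s] comm[OF ik(1,2) s])
    moreover have "(E i s * E k s) * (E i s * E k s) = E i s * E k s"
      by (metis EE comm ik(1,2) s mult.assoc)
    ultimately show "star (E i s * E k s) = E i s * E k s \<and>
        (E i s * E k s) * (E i s * E k s) = E i s * E k s" ..
  qed
  have total: "(\<Sum>i\<in>I. E i t) = 1" if t: "t \<in> {0..1}" for t
  proof -
    have "1 - (\<Sum>i\<in>I. E i t) = 0"
    proof (rule projection_path_zero[of "\<lambda>t. 1 - (\<Sum>i\<in>I. E i t)", OF _ _ _ t])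
      show "continuous_on {0..1} (\<lambda>t. 1 - (\<Sum>i\<in>I. E i t))"
        by (intro continuous_on_diff continuous_on_const continuous_on_sum cont_E)
      show "1 - (\<Sum>i\<in>I. E i 0) = 0"
        using e by (simp add: E0 resolution_def)
      fix s :: real assume s: "s \<in> {0..1}"
      have "(\<Sum>i\<in>I. E i s) * (\<Sum>i\<in>I. E i s) = (\<Sum>i\<in>I. \<Sum>k\<in>I. if i = k then E i s else 0)"
        unfolding sum_product by (intro sum.cong refl) (use s in \<open>simp add: EE orth\<close>)
      also have "\<dots> = (\<Sum>i\<in>I. E i s)"
        using fin by simp
      finally have "(\<Sum>i\<in>I. E i s) * (\<Sum>i\<in>I. E i s) = (\<Sum>i\<in>I. E i s)" .
      then show "star (1 - (\<Sum>i\<in>I. E i s)) = 1 - (\<Sum>i\<in>I. E i s) \<and>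
          (1 - (\<Sum>i\<in>I. E i s)) * (1 - (\<Sum>i\<in>I. E i s)) = 1 - (\<Sum>i\<in>I. E i s)"
        using s by (simp add: star_diff star_sum sE left_diff_distrib right_diff_distrib)
    qed
    then show ?thesis by simp
  qed
  define r where "r t = diag I (\<lambda>i. E i t) l" for t
  have res: "resolution I (\<lambda>i. E i t)" if "t \<in> {0..1}" for t
    using that fin by (simp add: resolution_def sE EE orth total)
  show ?thesis
  proof (rule that)
    have "continuous_on {0..1} r"
      unfolding r_def diag_def by (intro continuous_intros cont_E)
    then show "connected (r ` {0..1})"
      by (rule connected_continuous_image) simp
    show "r ` {0..1} \<subseteq> S_set (root_poly n l)"
      using diag_in_S_set[OF res[unfolded I_def]] by (auto simp: r_def I_def)
    have "r 0 = a" "r 1 = b"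
      by (simp_all add: r_def ae bf diag_def E0 E1)
    moreover have "r 0 \<in> r ` {0..1}" "r 1 \<in> r ` {0..1}"
      by (rule imageI; simp)+
    ultimately show "a \<in> r ` {0..1}" "b \<in> r ` {0..1}"
      by simp_all
  qed
qed

section \<open>The constant\<close>

lemma finite_gaps: "finite {\<bar>l \<alpha> - l \<beta>\<bar> | \<alpha> \<beta>. \<alpha> \<in> {1..n} \<and> \<beta> \<in> {1..n} \<and> \<alpha> \<noteq> \<beta>}" for l :: "nat \<Rightarrow> real"
  by (rule finite_subset[of _ "(\<lambda>(\<alpha>, \<beta>). \<bar>l \<alpha> - l \<beta>\<bar>) ` ({1..n} \<times> {1..n})"]) auto

lemma min_gap_le:
  "i \<in> {1..n} \<Longrightarrow> k \<in> {1..n} \<Longrightarrow> k \<noteq> i \<Longrightarrow> min_gap n l \<le> \<bar>l k - l i\<bar>"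
  unfolding min_gap_def by (rule Min_le[OF finite_gaps]) blast

lemma min_gap_attained:
  assumes "n \<ge> 2"
  obtains \<alpha> \<beta> where "\<alpha> \<in> {1..n}" "\<beta> \<in> {1..n}" "\<alpha> \<noteq> \<beta>" "min_gap n l = \<bar>l \<alpha> - l \<beta>\<bar>"
proof -
  have "\<bar>l 1 - l 2\<bar> \<in> {\<bar>l \<alpha> - l \<beta>\<bar> | \<alpha> \<beta>. \<alpha> \<in> {1..n} \<and> \<beta> \<in> {1..n} \<and> \<alpha> \<noteq> \<beta>}"
    using assms by (intro CollectI exI[of _ 1] exI[of _ 2]) auto
  then have "min_gap n l \<in> {\<bar>l \<alpha> - l \<beta>\<bar> | \<alpha> \<beta>. \<alpha> \<in> {1..n} \<and> \<beta> \<in> {1..n} \<and> \<alpha> \<noteq> \<beta>}"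
    unfolding min_gap_def by (intro Min_in finite_gaps) blast
  then show ?thesis
    using that by blast
qed

lemma max_gap_ge: "k \<in> {1..n} \<Longrightarrow> k \<noteq> j \<Longrightarrow> \<bar>l k - l j\<bar> \<le> max_gap n l j"
  unfolding max_gap_def by (rule Max_ge) auto

text \<open>If \<open>\<alpha>\<close> and \<open>\<beta>\<close> realise the minimal gap \<open>d\<close>, then the fraction with index \<open>\<alpha>\<close> is at most
  \<open>1\<close>: its numerator is \<open>d\<close> times a product over the remaining indices, whereas its denominator
  is at least \<open>d\<close> times the product of the larger numbers \<open>max_gap n l j\<close> over the same indices,
  by expansion of the factor with index \<open>\<beta>\<close> alone.\<close>

lemma bound_le_min_gap:
  assumes n: "n \<ge> 2"
  shows "min_gap n l *
    (MIN i\<in>{1..n}.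
      (\<Prod>j\<in>{1..n} - {i}. \<bar>l i - l j\<bar>) /
      ((\<Prod>j\<in>{1..n} - {i}. max_gap n l j + min_gap n l) - (\<Prod>j\<in>{1..n} - {i}. max_gap n l j)))
    \<le> min_gap n l" (is "_ * (MIN i\<in>_. ?q i) \<le> _")
proof -
  define d where "d = min_gap n l"
  define M where "M = max_gap n l"
  obtain \<alpha> \<beta> where ab: "\<alpha> \<in> {1..n}" "\<beta> \<in> {1..n}" "\<alpha> \<noteq> \<beta>" and dab: "d = \<bar>l \<alpha> - l \<beta>\<bar>"
    unfolding d_def using min_gap_attained[OF n] by blast
  define A where "A = {1..n} - {\<alpha>} - {\<beta>}"
  have d: "d \<ge> 0"
    by (simp add: dab)
  have M: "M j \<ge> 0" if "j \<in> {1..n}" for j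
  proof -
    obtain k where "k \<in> {1..n}" "k \<noteq> j"
      using ab by metis
    from max_gap_ge[OF this, of l] show ?thesis
      unfolding M_def by linarith
  qed
  have split: "(\<Prod>j\<in>{1..n} - {\<alpha>}. g j) = g \<beta> * (\<Prod>j\<in>A. g j)" for g :: "nat \<Rightarrow> real"
    unfolding A_def by (rule prod.remove) (use ab in auto)
  have "(\<Prod>j\<in>{1..n} - {\<alpha>}. \<bar>l \<alpha> - l j\<bar>) = d * (\<Prod>j\<in>A. \<bar>l \<alpha> - l j\<bar>)"
    by (simp only: split dab)
  also have "\<dots> \<le> d * (\<Prod>j\<in>A. M j)"
    unfolding M_def by (intro mult_left_mono prod_mono d conjI max_gap_ge)
      (use ab in \<open>auto simp: A_def\<close>)
  also have "\<dots> = (M \<beta> + d) * (\<Prod>j\<in>A. M j) - M \<beta> * (\<Prod>j\<in>A. M j)"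
    by (simp add: algebra_simps)
  also have "\<dots> \<le> (M \<beta> + d) * (\<Prod>j\<in>A. M j + d) - M \<beta> * (\<Prod>j\<in>A. M j)"
    using M ab d by (intro diff_right_mono mult_left_mono prod_mono) (auto simp: A_def)
  also have "\<dots> = (\<Prod>j\<in>{1..n} - {\<alpha>}. M j + d) - (\<Prod>j\<in>{1..n} - {\<alpha>}. M j)"
    by (simp only: split)
  finally have le: "(\<Prod>j\<in>{1..n} - {\<alpha>}. \<bar>l \<alpha> - l j\<bar>) \<le>
      (\<Prod>j\<in>{1..n} - {\<alpha>}. M j + d) - (\<Prod>j\<in>{1..n} - {\<alpha>}. M j)" .
  have "x / y \<le> 1" if "0 \<le> x" "x \<le> y" for x y :: real
    using that by (cases "y = 0") auto
  from this[OF prod_nonneg le] have "?q \<alpha> \<le> 1"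
    by (simp add: d_def M_def)
  moreover have "(MIN i\<in>{1..n}. ?q i) \<le> ?q \<alpha>"
    using ab by (intro Min_le) auto
  ultimately have "(MIN i\<in>{1..n}. ?q i) \<le> 1"
    by linarith
  then show ?thesis
    using d unfolding d_def by (rule mult_left_le)
qed

section \<open>The distance of components\<close>

theorem theorem18:
  fixes n :: nat and l :: "nat \<Rightarrow> real" and C D :: "'a::unital_cstar_algebra set"
  assumes "n \<ge> 2"
    and "inj_on l {1..n}"
    and "C \<in> components (S_set (root_poly n l))"
    and "D \<in> components (S_set (root_poly n l))"
    and "C \<noteq> D"
  shows "setdist C D \<ge> min_gap n l *
    (MIN i\<in>{1..n}.
      (\<Prod>j\<in>{1..n} - {i}. \<bar>l i - l j\<bar>) /
      ((\<Prod>j\<in>{1..n} - {i}. max_gap n l j + min_gap n l) - (\<Prod>j\<in>{1..n} - {i}. max_gap n l j)))"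
proof (rule order_trans[OF bound_le_min_gap[OF assms(1)]], rule le_setdistI)
  show "C \<noteq> {}" "D \<noteq> {}"
    using assms(3,4) in_components_nonempty by blast+
  fix a b assume a: "a \<in> C" and b: "b \<in> D"
  show "min_gap n l \<le> dist a b"
  proof (rule ccontr)
    assume "\<not> min_gap n l \<le> dist a b"
    then have close: "norm (a - b) < min_gap n l"
      by (simp add: dist_norm)
    have "a \<in> S_set (root_poly n l)" "b \<in> S_set (root_poly n l)"
      using a b assms(3,4) in_components_subset by blast+
    from close_points_in_connected_subset[OF this assms(2) min_gap_le close]
    obtain T where T: "connected T" "T \<subseteq> S_set (root_poly n l)" "a \<in> T" "b \<in> T" .
    have "T \<subseteq> C" "T \<subseteq> D"
      using components_maximal[OF assms(3) T(1,2)] components_maximal[OF assms(4) T(1,2)] a b T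
      by blast+
    then have "C \<inter> D \<noteq> {}"
      using T(3) by blast
    then show False
      using components_eq[OF assms(3,4)] assms(5) by blast
  qed
qed

end
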